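(* Let $d\ge 2$ and let $Q_1,Q_2\subset\mathbb{RP}^d$ be distinct non-empty non-degenerate quadrics defined by non-degenerate quadratic forms $q_1,q_2$ on $\mathbb{R}^{d+1}$. Then any quadric $Q\neq Q_1$ defined by a quadratic form $q$ belonging to the pencil of $(q_1,q_2)$-confocal quadrics $\mathcal{F}(q_1^*,q_2^* )^*$ is a caustic of the line-framed hypersurface $\Sigma_{q_2}$ over $Q_1$ induced by $q_2$.
   Context: For a non-degenerate quadratic form $q$ on $\mathbb{R}^{d+1}$ (also denoting its bilinear form), write $q(x,y)=\mathcal{Q}_0(Mx,y)$ with $\mathcal{Q}_0=\sum_{j=0}^d x_j^2$ and $M$ an invertible matrix; its dual form is $q^*(x,y)=\mathcal{Q}_0(M^{-1}x,y)$. For non-colinear quadratic forms $f,g$, $\mathcal{F}(f,g)=\{\lambda f+\mu g:(\lambda,\mu)\in\mathbb{R}^2\setminus\{0\}\}$, and $\mathcal{F}(f,g)^*$ is the set of duals $h^*$ of the non-degenerate forms $h\in\mathcal{F}(f,g)$. A quadric in $\mathbb{RP}^d$ is the zero set of a non-zero quadratic form, non-degenerate if the form is. The pole of a projective hyperplane $\mathbb{P}(W)$ with respect to a non-degenerate form $q$ is the point $\mathbb{P}(W^{\perp_q})$. For $p\in Q_1$ let $u$ be the pole of $T_pQ_1$ with respect to $q_2$; when $u\ne p$ let $L_{q_2}(p)$ be the line $pu$. Then $\Sigma_{q_2}=\{(p,L_{q_2}(p))\}$, where $p$ ranges over the points of $Q_1$ at which $L_{q_2}(p)$ is defined and transverse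 to $Q_1$. Projective reflection law at $p$ for a field of transverse lines $L$ on a hypersurface $S$: a line $\ell\ni p$ transverse to $S$ is reflected into $\ell'\ni p$ if $\ell'$ is the image of $\ell$ by the unique non-trivial projective involution of the space of lines through $p$ fixing $L(p)$ and all lines of $T_pS$ through $p$ (equivalently $\ell,\ell',L(p)$ lie in a plane $\mathcal{P}$ and $(\ell,\ell',L(p),T_pS\cap\mathcal{P})$ is a harmonic quadruple of lines). A hypersurface $\Gamma$ is a caustic of the line-framed hypersurface if every line tangent to $\Gamma$ and intersecting $S$ transversally at a point $p$ (where the frame is defined) is reflected into a line tangent to $\Gamma$ by the projective reflection law at $p$. *)

theory Defs
  imports "HOL-Analysis.Analysis"
begin

text \<open>
  The space \<open>\<real>\<^sup>d\<^sup>+\<^sup>1\<close> is \<open>real ^ 'n\<close> with \<open>CARD('n) = d + 1\<close>. A projective subspace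
  \<open>\<bbbP>(W)\<close> of \<open>\<real>\<bbbP>\<^sup>d\<close> is represented by the linear subspace \<open>W\<close> itself, so that incidence is
  inclusion, and a subset of \<open>\<real>\<bbbP>\<^sup>d\<close> is a set of one-dimensional linear subspaces.
\<close>

type_synonym 'n proj = "(real ^ 'n) set"

definition proj_point :: "'n::finite proj \<Rightarrow> bool" where
  "proj_point p \<longleftrightarrow> subspace p \<and> dim p = 1"

definition proj_line :: "'n::finite proj \<Rightarrow> bool" where
  "proj_line l \<longleftrightarrow> subspace l \<and> dim l = 2"

text \<open>A quadratic form is given by its symmetric bilinear form; its value at \<open>x\<close> is \<open>q x x\<close>.\<close>

type_synonym 'n form = "real ^ 'n \<Rightarrow> real ^ 'n \<Rightarrow> real"

definition quadratic_form :: "'n::finite form \<Rightarrow> bool" where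
  "quadratic_form q \<longleftrightarrow> bilinear q \<and> (\<forall>x y. q x y = q y x)"

definition nondegenerate :: "'n::finite form \<Rightarrow> bool" where
  "nondegenerate q \<longleftrightarrow> (\<forall>x. (\<forall>y. q x y = 0) \<longrightarrow> x = 0)"

definition form_matrix :: "'n::finite form \<Rightarrow> real ^ 'n ^ 'n" where
  "form_matrix q = (THE M. \<forall>x y. q x y = (M *v x) \<bullet> y)"

definition dual_form :: "'n::finite form \<Rightarrow> 'n form" where
  "dual_form q = (\<lambda>x y. (matrix_inv (form_matrix q) *v x) \<bullet> y)"

definition pencil :: "'n::finite form \<Rightarrow> 'n form \<Rightarrow> 'n form set" where
  "pencil f g = {(\<lambda>x y. a * f x y + b * g x y) | a b. (a, b) \<noteq> (0, 0)}"

definition dual_pencil :: "'n::finite form \<Rightarrow> 'n form \<Rightarrow> 'n form set" where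
  "dual_pencil f g = {dual_form h | h. h \<in> pencil f g \<and> nondegenerate h}"

definition quadric :: "'n::finite form \<Rightarrow> 'n proj set" where
  "quadric q = {p. proj_point p \<and> (\<forall>x\<in>p. q x x = 0)}"

text \<open>The pole of \<open>\<bbbP>(W)\<close> with respect to \<open>q\<close>: a projective point if \<open>W\<close> is a hyperplane and
  \<open>q\<close> is non-degenerate.\<close>

definition pole :: "'n::finite form \<Rightarrow> 'n proj \<Rightarrow> 'n proj" where
  "pole q W = {x. \<forall>y\<in>W. q x y = 0}"

text \<open>\<open>\<Union>S\<close> is the cone over \<open>S\<close> in \<open>\<real>\<^sup>d\<^sup>+\<^sup>1\<close>; away from the origin it is a hypersurface exactly
  when \<open>S\<close> is a hypersurface of \<open>\<real>\<bbbP>\<^sup>d\<close>. The function \<open>f\<close> is a local equation of it, of class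
  \<open>C\<^sup>1\<close> with gradient \<open>G\<close>.\<close>

definition hypersurface :: "'n::finite proj set \<Rightarrow> bool" where
  "hypersurface S \<longleftrightarrow>
     (\<forall>p\<in>S. proj_point p) \<and>
     (\<forall>x\<in>\<Union>S - {0}. \<exists>U (f :: real ^ 'n \<Rightarrow> real) G.
        open U \<and> x \<in> U \<and>
        (\<forall>y\<in>U. (f has_derivative (\<lambda>h. G y \<bullet> h)) (at y)) \<and>
        continuous_on U G \<and> G x \<noteq> 0 \<and>
        (\<forall>y\<in>U. y \<in> \<Union>S \<longleftrightarrow> f y = 0))"

text \<open>The projective tangent space \<open>T\<^sub>pS\<close>, as a linear subspace containing \<open>p\<close>: the velocities at
  representatives \<open>x\<close> of \<open>p\<close> of curves in the cone over \<open>S\<close>.\<close>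

definition tangent_space :: "'n::finite proj set \<Rightarrow> 'n proj \<Rightarrow> 'n proj" where
  "tangent_space S p =
     {v. \<exists>x \<gamma>. x \<in> p \<and> x \<noteq> 0 \<and> \<gamma> 0 = x \<and>
            (\<gamma> has_vector_derivative v) (at (0::real)) \<and>
            (\<forall>\<^sub>F t in nhds 0. \<gamma> t \<in> \<Union>S)}"

definition tangent_line :: "'n::finite proj \<Rightarrow> 'n proj set \<Rightarrow> bool" where
  "tangent_line l S \<longleftrightarrow> proj_line l \<and> (\<exists>r\<in>S. r \<subseteq> l \<and> l \<subseteq> tangent_space S r)"

definition transverse_line_at :: "'n::finite proj \<Rightarrow> 'n proj set \<Rightarrow> 'n proj \<Rightarrow> bool" where
  "transverse_line_at l S p \<longleftrightarrow>
     proj_line l \<and> p \<in> S \<and> p \<subseteq> l \<and> \<not> l \<subseteq> tangent_space S p"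

text \<open>The line-framed hypersurface \<open>\<Sigma>\<^sub>q\<close> over \<open>S\<close> induced by \<open>q\<close>, as the set of pairs
  \<open>(p, L\<^sub>q(p))\<close>; \<open>span (p \<union> u)\<close> is the projective line \<open>pu\<close>.\<close>

definition line_frame :: "'n::finite proj set \<Rightarrow> 'n form \<Rightarrow> ('n proj \<times> 'n proj) set" where
  "line_frame S q =
     {(p, span (p \<union> u)) | p u.
        p \<in> S \<and> u = pole q (tangent_space S p) \<and> u \<noteq> p \<and>
        transverse_line_at (span (p \<union> u)) S p}"

definition lines_through :: "'n::finite proj \<Rightarrow> 'n proj set" where
  "lines_through p = {l. proj_line l \<and> p \<subseteq> l}"

text \<open>The projective transformations of the space \<open>\<bbbP>(\<real>\<^sup>d\<^sup>+\<^sup>1/p)\<close> of lines through \<open>p\<close>: they are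
  induced by the linear automorphisms of \<open>\<real>\<^sup>d\<^sup>+\<^sup>1\<close> preserving \<open>p\<close>, because every automorphism of
  the quotient lifts. Extensionality makes the \<open>THE\<close> in \<open>proj_reflection\<close> well-defined.\<close>

definition projectivity_at :: "'n::finite proj \<Rightarrow> ('n proj \<Rightarrow> 'n proj) \<Rightarrow> bool" where
  "projectivity_at p \<phi> \<longleftrightarrow>
     \<phi> \<in> extensional (lines_through p) \<and>
     (\<exists>A. linear A \<and> bij A \<and> A ` p = p \<and> (\<forall>l\<in>lines_through p. \<phi> l = A ` l))"

definition proj_reflection :: "'n::finite proj \<Rightarrow> 'n proj \<Rightarrow> 'n proj \<Rightarrow> 'n proj \<Rightarrow> 'n proj" where
  "proj_reflection p T L =
     (THE \<phi>. projectivity_at p \<phi> \<and>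
        (\<forall>l\<in>lines_through p. \<phi> (\<phi> l) = l) \<and>
        (\<exists>l\<in>lines_through p. \<phi> l \<noteq> l) \<and>
        \<phi> L = L \<and>
        (\<forall>l\<in>lines_through p. l \<subseteq> T \<longrightarrow> \<phi> l = l))"

definition caustic :: "'n::finite proj set \<Rightarrow> 'n proj set \<Rightarrow> ('n proj \<times> 'n proj) set \<Rightarrow> bool" where
  "caustic \<Gamma> S \<Sigma> \<longleftrightarrow>
     hypersurface \<Gamma> \<and>
     (\<forall>(p, L)\<in>\<Sigma>. \<forall>l. tangent_line l \<Gamma> \<and> transverse_line_at l S p \<longrightarrow>
        tangent_line (proj_reflection p (tangent_space S p) L l) \<Gamma>)"

end

theory Submission imports Defs begin

text \<open>
  The theorem becomes linear algebra once tangency is expressed by covectors. Write \<open>M\<^sub>1\<close>,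
  \<open>M\<^sub>2\<close> for the matrices of \<open>q1\<close>, \<open>q2\<close>. The dual form of \<open>q\<close> has the matrix
  \<open>N = a M\<^sub>1\<^sup>-\<^sup>1 + b M\<^sub>2\<^sup>-\<^sup>1\<close>. A line \<open>l\<close> is tangent to the quadric of \<open>q\<close> if and only if some
  non-zero covector \<open>\<eta>\<close> vanishes on \<open>l\<close> and satisfies \<open>N \<eta> \<in> l\<close>: the covector is a tangent
  hyperplane containing \<open>l\<close>, and \<open>N \<eta>\<close> is its contact point (\<open>tangent_line_dual_quadric_iff\<close>).

  Let \<open>x\<close> represent a point of the first quadric. Its tangent hyperplane is the kernel of
  \<open>\<xi> = M\<^sub>1 x\<close>, with pole \<open>u = M\<^sub>2\<^sup>-\<^sup>1 \<xi>\<close> with respect to \<open>q2\<close> (\<open>line_frame_obtain\<close>). The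
  projective reflection at this point is induced by the linear map \<open>A\<close> that is the identity on
  the kernel of \<open>\<xi>\<close> and maps \<open>u\<close> to \<open>-u\<close> (\<open>proj_reflection_eq\<close>).

  The point of the argument is that \<open>N \<xi> = a x + b u\<close> for every member of the dual pencil. For
  covectors \<open>\<eta>\<close> that vanish at \<open>x\<close> this gives \<open>N(\<eta>, \<xi>) = b (\<eta> \<bullet> u)\<close>, so that on the space
  of these covectors the transpose of \<open>A\<close> is the orthogonal reflection in \<open>\<xi>\<close> for \<open>N\<close>,
  whatever the coefficients \<open>a\<close>, \<open>b\<close> with \<open>b \<noteq> 0\<close>. It therefore carries a covector witnessing
  that \<open>l\<close> is tangent to one that witnesses it for \<open>A ` l\<close>. The computation in
  \<open>confocal_reflection_tangent\<close> verifies this directly, without dividing by \<open>N(\<xi>, \<xi>)\<close>.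
\<close>

section \<open>Matrices of quadratic forms\<close>

lemma form_matrix_eq:
  assumes "\<And>x y. q x y = (M *v x) \<bullet> y"
  shows "form_matrix q = M"
  unfolding form_matrix_def
proof (rule the_equality)
  fix M'
  assume "\<forall>x y. q x y = (M' *v x) \<bullet> y"
  then have "M' *v x = M *v x" for x
    using assms vector_eq_ldot by (metis inner_commute)
  then show "M' = M"
    by (simp add: matrix_eq)
qed (use assms in simp)

lemma form_matrix_works:
  fixes q :: "'n::finite form"
  assumes "quadratic_form q"
  shows "q x y = (form_matrix q *v x) \<bullet> y"
proof -
  have bil: "bilinear q"
    using assms by (simp add: quadratic_form_def)
  define f where "f = (\<lambda>x. \<chi> i. q x (axis i 1))"
  have "linear f"
    by (rule linearI)
       (simp_all add: f_def vec_eq_iff bilinear_ladd[OF bil] bilinear_lmul[OF bil])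
  moreover have "q x y = f x \<bullet> y" for x y
  proof -
    have lin: "linear (q x)"
      using bil by (simp add: bilinear_def)
    have "q x y = q x (\<Sum>i\<in>UNIV. y $ i *\<^sub>R axis i 1)"
      by (metis basis_expansion scalar_mult_eq_scaleR)
    also have "\<dots> = (\<Sum>i\<in>UNIV. y $ i * q x (axis i 1))"
      by (simp add: linear_sum[OF lin] linear_scale[OF lin])
    finally show ?thesis
      by (simp add: f_def inner_vec_def mult.commute)
  qed
  ultimately have rep: "q x y = (matrix f *v x) \<bullet> y" for x y
    by (simp add: matrix_works)
  then show ?thesis
    using form_matrix_eq by metis
qed

lemma form_matrix_symmetric:
  assumes "quadratic_form q"
  shows "(form_matrix q *v x) \<bullet> y = x \<bullet> (form_matrix q *v y)"
  by (metis assms form_matrix_works inner_commute quadratic_form_def)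

lemma form_matrix_invertible:
  fixes q :: "'n::finite form"
  assumes "quadratic_form q" and "nondegenerate q"
  shows "invertible (form_matrix q)"
proof -
  have "x = 0" if "form_matrix q *v x = 0" for x
    using assms that unfolding nondegenerate_def
    by (simp add: form_matrix_works)
  then show ?thesis
    by (metis invertible_left_inverse matrix_left_invertible_ker)
qed

lemma form_matrix_inverse:
  fixes q :: "'n::finite form"
  assumes "quadratic_form q" and "nondegenerate q"
  shows "form_matrix q *v (matrix_inv (form_matrix q) *v x) = x"
    and "matrix_inv (form_matrix q) *v (form_matrix q *v x) = x"
proof -
  let ?M = "form_matrix q"
  have "?M ** matrix_inv ?M = mat 1 \<and> matrix_inv ?M ** ?M = mat 1"
    using form_matrix_invertible[OF assms] unfolding invertible_def matrix_inv_def
    by (rule someI_ex)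
  then show "?M *v (matrix_inv ?M *v x) = x" "matrix_inv ?M *v (?M *v x) = x"
    by (simp_all add: matrix_vector_mul_assoc)
qed

lemma quadratic_form_matrixI:
  fixes M :: "real ^ 'n ^ 'n"
  assumes "\<And>x y. (M *v x) \<bullet> y = x \<bullet> (M *v y)"
  shows "quadratic_form (\<lambda>x y. (M *v x) \<bullet> y)"
  unfolding quadratic_form_def bilinear_def
  using assms
  by (auto intro!: linearI simp: inner_left_distrib inner_right_distrib
      matrix_vector_right_distrib matrix_vector_mult_scaleR inner_commute)

lemma dual_form_quadratic:
  fixes q :: "'n::finite form"
  assumes "quadratic_form q" and "nondegenerate q"
  shows "quadratic_form (dual_form q)"
  unfolding dual_form_def
  by (rule quadratic_form_matrixI) (metis assms form_matrix_inverse(1) form_matrix_symmetric)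

lemma dual_form_nondegenerate:
  fixes q :: "'n::finite form"
  assumes "quadratic_form q" and "nondegenerate q"
  shows "nondegenerate (dual_form q)"
  unfolding nondegenerate_def dual_form_def
  by (metis assms form_matrix_inverse(1) inner_eq_zero_iff matrix_vector_mult_0_right)

lemma form_matrix_dual:
  "form_matrix (dual_form q) = matrix_inv (form_matrix q)"
  by (rule form_matrix_eq) (simp add: dual_form_def)

lemma pencil_quadratic_form:
  assumes "quadratic_form f" and "quadratic_form g"
  shows "quadratic_form (\<lambda>x y. a * f x y + b * g x y)"
  using assms unfolding quadratic_form_def bilinear_def
  by (auto intro!: linearI simp: linear_add linear_scale algebra_simps)

lemma form_matrix_pencil:
  assumes "quadratic_form f" and "quadratic_form g"
  shows "form_matrix (\<lambda>x y. a * f x y + b * g x y) =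
    a *\<^sub>R form_matrix f + b *\<^sub>R form_matrix g"
  by (rule form_matrix_eq)
     (simp add: assms form_matrix_works matrix_vector_mult_add_rdistrib inner_left_distrib
       flip: scaleR_matrix_vector_assoc)

section \<open>Quadrics and their tangent lines\<close>

lemma proj_point_span:
  assumes "proj_point p" and "x \<in> p" and "x \<noteq> 0"
  shows "p = span {x}"
proof -
  have "span {x} \<subseteq> p"
    using assms by (simp add: proj_point_def span_minimal)
  moreover have "dim (span {x}) = dim p"
    using assms by (simp add: proj_point_def dim_singleton)
  ultimately show ?thesis
    using assms by (metis order_refl proj_point_def subspace_dim_equal subspace_span)
qed

lemma proj_point_obtain:
  assumes "proj_point p"
  obtains x where "x \<noteq> 0" and "p = span {x}"
proof -
  have "\<not> p \<subseteq> {0}"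
    using assms by (metis dim_eq_0 proj_point_def zero_neq_one)
  then show ?thesis
    using that proj_point_span[OF assms] by blast
qed

lemma proj_point_spanI: "x \<noteq> 0 \<Longrightarrow> proj_point (span {x})"
  by (simp add: proj_point_def dim_singleton)

lemma span_in_quadric_iff:
  assumes "quadratic_form q" and "x \<noteq> 0"
  shows "span {x} \<in> quadric q \<longleftrightarrow> q x x = 0"
proof -
  have bil: "bilinear q"
    using assms by (simp add: quadratic_form_def)
  have "(\<forall>y\<in>span {x}. q y y = 0) \<longleftrightarrow> q x x = 0"
    by (auto simp: span_singleton span_base bilinear_lmul[OF bil] bilinear_rmul[OF bil]
        dest: spec[of _ 1])
  then show ?thesis
    using assms(2) by (simp add: quadric_def proj_point_spanI)
qed

lemma in_Union_quadric_iff: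
  assumes "quadratic_form q" and "quadric q \<noteq> {}"
  shows "y \<in> \<Union>(quadric q) \<longleftrightarrow> q y y = 0"
proof
  show "q y y = 0" if "y \<in> \<Union>(quadric q)"
    using that by (auto simp: quadric_def)
next
  assume y: "q y y = 0"
  show "y \<in> \<Union>(quadric q)"
  proof (cases "y = 0")
    case True
    obtain p where "p \<in> quadric q"
      using assms(2) by blast
    moreover from this have "0 \<in> p"
      by (simp add: quadric_def proj_point_def subspace_0)
    ultimately show ?thesis
      using True by blast
  next
    case False
    then have "span {y} \<in> quadric q"
      using y assms(1) by (simp add: span_in_quadric_iff)
    then show ?thesis
      by (meson UnionI insertI1 span_base)
  qed
qed

lemma quadric_hypersurface:
  fixes q :: "'n::finite form"
  assumes "quadratic_form q" and "nondegenerate q"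
  shows "hypersurface (quadric q)"
  unfolding hypersurface_def
proof (intro conjI ballI)
  show "proj_point p" if "p \<in> quadric q" for p
    using that by (simp add: quadric_def)
next
  fix x
  assume x: "x \<in> \<Union>(quadric q) - {0}"
  define G where "G = (\<lambda>y. 2 *\<^sub>R (form_matrix q *v y))"
  have deriv: "((\<lambda>y. q y y) has_derivative (\<lambda>h. G y \<bullet> h)) (at y)" for y
  proof -
    have "bounded_bilinear q"
      using assms(1) by (simp add: quadratic_form_def bilinear_conv_bounded_bilinear)
    then have "((\<lambda>y. q y y) has_derivative (\<lambda>h. q y h + q h y)) (at y)"
      by (rule bounded_bilinear.FDERIV) (auto intro: has_derivative_ident)
    moreover have "q y h + q h y = G y \<bullet> h" for h
      using assms(1) form_matrix_works[OF assms(1), of y h]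
      by (simp add: G_def quadratic_form_def)
    ultimately show ?thesis
      by simp
  qed
  have "continuous_on UNIV G"
    unfolding G_def by (intro continuous_intros matrix_vector_mult_linear_continuous_on)
  moreover have "G x \<noteq> 0"
    using x form_matrix_inverse(2)[OF assms, of x] by (auto simp: G_def)
  moreover have "y \<in> \<Union>(quadric q) \<longleftrightarrow> q y y = 0" for y
    using x by (intro in_Union_quadric_iff assms) auto
  ultimately show "\<exists>U f G. open U \<and> x \<in> U \<and>
        (\<forall>y\<in>U. (f has_derivative (\<lambda>h. G y \<bullet> h)) (at y)) \<and>
        continuous_on U G \<and> G x \<noteq> 0 \<and> (\<forall>y\<in>U. y \<in> \<Union>(quadric q) \<longleftrightarrow> f y = 0)"
    using deriv by (intro exI[of _ UNIV] exI[of _ "\<lambda>y. q y y"] exI[of _ G]) auto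
qed

text \<open>Differentiating \<open>q (\<gamma> t) (\<gamma> t) = 0\<close> bounds the velocities of curves in the cone.
  Conversely, with a vector \<open>w\<close> completing \<open>x\<close> to a hyperbolic pair, the equation
  \<open>q (\<gamma> t) (\<gamma> t) = 0\<close> for \<open>\<gamma> t = x + t v + s w\<close> is linear in \<open>s\<close>, and its solution \<open>s\<close> is of
  second order in \<open>t\<close>.\<close>

lemma tangent_space_quadric:
  fixes q :: "'n::finite form"
  assumes q: "quadratic_form q" "nondegenerate q"
    and x: "x \<noteq> 0" "span {x} \<in> quadric q"
  shows "tangent_space (quadric q) (span {x}) = {v. q x v = 0}"
proof (intro set_eqI iffI CollectI)
  have bil: "bilinear q" and sym: "\<And>a b. q a b = q b a"
    using q by (auto simp: quadratic_form_def)
  note bl = bilinear_ladd[OF bil] bilinear_radd[OF bil] bilinear_lmul[OF bil]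
    bilinear_rmul[OF bil] bilinear_lsub[OF bil] bilinear_rsub[OF bil]
  have cone: "y \<in> \<Union>(quadric q) \<longleftrightarrow> q y y = 0" for y
    using x by (intro in_Union_quadric_iff q) auto
  have xx: "q x x = 0"
    using x q by (simp add: span_in_quadric_iff)
  fix v
  {
    assume "v \<in> tangent_space (quadric q) (span {x})"
    then obtain z \<gamma> where z: "z \<in> span {x}" "z \<noteq> 0" "\<gamma> 0 = z"
      and \<gamma>: "(\<gamma> has_vector_derivative v) (at (0::real))"
      and ev: "\<forall>\<^sub>F t in nhds 0. \<gamma> t \<in> \<Union>(quadric q)"
      unfolding tangent_space_def by blast
    have "bounded_bilinear q"
      using bil by (simp add: bilinear_conv_bounded_bilinear)
    then have "((\<lambda>t. q (\<gamma> t) (\<gamma> t)) has_vector_derivative q (\<gamma> 0) v + q v (\<gamma> 0)) (at 0)"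
      using \<gamma> by (rule bounded_bilinear.has_vector_derivative[OF _ \<gamma>])
    moreover have "((\<lambda>t. q (\<gamma> t) (\<gamma> t)) has_vector_derivative 0) (at 0)"
    proof -
      obtain U where U: "open U" "0 \<in> U" "\<And>t. t \<in> U \<Longrightarrow> q (\<gamma> t) (\<gamma> t) = 0"
        using ev unfolding eventually_nhds cone by blast
      show ?thesis
        by (rule has_vector_derivative_transform_within_open[of "\<lambda>_. 0" 0 0 U])
           (use U in auto)
    qed
    ultimately have "2 * q z v = 0"
      using vector_derivative_unique_at z(3) sym by fastforce
    moreover obtain k where "z = k *\<^sub>R x"
      using z(1) by (auto simp: span_singleton)
    ultimately show "q x v = 0"
      using z(2) by (simp add: bl)
  next
    assume v: "v \<in> {v. q x v = 0}"
    then have xv: "q x v = 0"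
      by simp
    obtain w0 where w0: "q x w0 \<noteq> 0"
      using q(2) x(1) unfolding nondegenerate_def by blast
    define w1 where "w1 = (1 / q x w0) *\<^sub>R w0"
    define w where "w = w1 - (q w1 w1 / 2) *\<^sub>R x"
    have "q x w1 = 1"
      using w0 by (simp add: w1_def bl)
    then have xw: "q x w = 1" and ww: "q w w = 0"
      by (simp_all add: w_def bl xx sym[of w1 x])
    \<comment> \<open>The solution \<open>s\<close> of \<open>q (\<gamma> t) (\<gamma> t) = t\<^sup>2 q(v,v) + 2 s (1 + t q(v,w)) = 0\<close>; here
      \<open>q w w = 0\<close> removes the quadratic term in \<open>s\<close>.\<close>
    define s where "s = (\<lambda>t. - (t\<^sup>2 * q v v) / (2 * (1 + t * q v w)))"
    define \<gamma> where "\<gamma> = (\<lambda>t. x + t *\<^sub>R v + s t *\<^sub>R w)"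
    have "(s has_real_derivative 0) (at 0)"
      unfolding s_def by (auto intro!: derivative_eq_intros)
    then have "(\<gamma> has_vector_derivative v) (at 0)"
      unfolding \<gamma>_def by (auto intro!: derivative_eq_intros)
    moreover have "\<forall>\<^sub>F t in nhds 0. \<gamma> t \<in> \<Union>(quadric q)"
    proof -
      have "((\<lambda>t. 1 + t * q v w) \<longlongrightarrow> 1 + 0 * q v w) (nhds 0)"
        by (intro tendsto_intros filterlim_ident)
      then have "\<forall>\<^sub>F t in nhds 0. 1 + t * q v w \<noteq> 0"
        by (rule tendsto_imp_eventually_ne) simp
      then show ?thesis
      proof eventually_elim
        case (elim t)
        have "q (\<gamma> t) (\<gamma> t) = t\<^sup>2 * q v v + s t * (2 * (1 + t * q v w))"
          using sym[of v x] sym[of w x] sym[of w v]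
          by (simp add: \<gamma>_def bl xx xv xw ww algebra_simps power2_eq_square)
        also have "\<dots> = 0"
          using elim by (simp add: s_def)
        finally show ?case
          using cone by blast
      qed
    qed
    moreover have "\<gamma> 0 = x"
      by (simp add: \<gamma>_def s_def)
    ultimately show "v \<in> tangent_space (quadric q) (span {x})"
      unfolding tangent_space_def using x(1) span_base by blast
  }
qed

text \<open>A line is tangent to a non-degenerate quadric exactly when the form is degenerate on it:
  the contact point spans a radical vector.\<close>

lemma tangent_line_quadric_iff:
  fixes q :: "'n::finite form"
  assumes "quadratic_form q" and "nondegenerate q"
  shows "tangent_line l (quadric q) \<longleftrightarrow>
    proj_line l \<and> (\<exists>y\<in>l. y \<noteq> 0 \<and> (\<forall>z\<in>l. q y z = 0))"
proof
  assume "tangent_line l (quadric q)"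
  then obtain r where l: "proj_line l" "r \<in> quadric q" "r \<subseteq> l"
    "l \<subseteq> tangent_space (quadric q) r"
    unfolding tangent_line_def by blast
  from l(2) obtain y where y: "y \<noteq> 0" "r = span {y}"
    using proj_point_obtain by (auto simp: quadric_def)
  then have "y \<in> l"
    using l(3) span_base by blast
  then show "proj_line l \<and> (\<exists>y\<in>l. y \<noteq> 0 \<and> (\<forall>z\<in>l. q y z = 0))"
    using l y tangent_space_quadric[OF assms, of y] by blast
next
  assume "proj_line l \<and> (\<exists>y\<in>l. y \<noteq> 0 \<and> (\<forall>z\<in>l. q y z = 0))"
  then obtain y where l: "proj_line l" and y: "y \<in> l" "y \<noteq> 0" "\<forall>z\<in>l. q y z = 0"
    by blast
  then have r: "span {y} \<in> quadric q"
    using assms by (simp add: span_in_quadric_iff)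
  moreover have "span {y} \<subseteq> l"
    using l y by (simp add: proj_line_def span_minimal)
  ultimately show "tangent_line l (quadric q)"
    unfolding tangent_line_def
    using l y tangent_space_quadric[OF assms y(2) r] by blast
qed

text \<open>The same criterion for the quadric with dual form \<open>h\<close>, in terms of \<open>h\<close> alone: the covector
  \<open>\<eta>\<close> is the hyperplane tangent at the contact point, and the matrix of \<open>h\<close> sends this
  hyperplane to the contact point.\<close>

lemma tangent_line_dual_quadric_iff:
  fixes h :: "'n::finite form"
  assumes h: "quadratic_form h" "nondegenerate h"
  shows "tangent_line l (quadric (dual_form h)) \<longleftrightarrow>
    proj_line l \<and> (\<exists>\<eta>. \<eta> \<noteq> 0 \<and> (\<forall>z\<in>l. \<eta> \<bullet> z = 0) \<and> form_matrix h *v \<eta> \<in> l)"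
proof -
  have "(\<exists>y\<in>l. y \<noteq> 0 \<and> (\<forall>z\<in>l. dual_form h y z = 0)) \<longleftrightarrow>
    (\<exists>\<eta>. \<eta> \<noteq> 0 \<and> (\<forall>z\<in>l. \<eta> \<bullet> z = 0) \<and> form_matrix h *v \<eta> \<in> l)"
    unfolding dual_form_def
    by (metis form_matrix_inverse[OF h] matrix_vector_mult_0_right)
  then show ?thesis
    by (simp add: tangent_line_quadric_iff dual_form_quadratic dual_form_nondegenerate h)
qed

section \<open>The projective reflection at a point\<close>

text \<open>For \<open>\<xi> \<bullet> u \<noteq> 0\<close>, this is the identity on the kernel of \<open>\<xi>\<close> and \<open>-1\<close> on the axis \<open>u\<close>.\<close>

definition oblique_reflection :: "real ^ 'n \<Rightarrow> real ^ 'n \<Rightarrow> real ^ 'n \<Rightarrow> real ^ 'n" where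
  "oblique_reflection \<xi> u v = v - (2 * (\<xi> \<bullet> v) / (\<xi> \<bullet> u)) *\<^sub>R u"

lemma oblique_reflection_linear: "linear (oblique_reflection \<xi> u)"
  by (rule linearI)
     (simp_all add: oblique_reflection_def inner_right_distrib algebra_simps
       add_divide_distrib)

lemma oblique_reflection_involution:
  "\<xi> \<bullet> u \<noteq> 0 \<Longrightarrow> oblique_reflection \<xi> u (oblique_reflection \<xi> u v) = v"
  by (simp add: oblique_reflection_def inner_diff_right algebra_simps)

lemma oblique_reflection_fixes: "\<xi> \<bullet> v = 0 \<Longrightarrow> oblique_reflection \<xi> u v = v"
  by (simp add: oblique_reflection_def)

text \<open>The transpose of an oblique reflection exchanges the roles of axis and hyperplane.\<close>

lemma oblique_reflection_transpose:
  "oblique_reflection u \<xi> \<eta> \<bullet> v = \<eta> \<bullet> oblique_reflection \<xi> u v"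
  by (simp add: oblique_reflection_def inner_diff_left inner_diff_right inner_commute)

lemma dim_span_pair:
  fixes x y :: "'a::euclidean_space"
  assumes "x \<noteq> 0" and "y \<notin> span {x}"
  shows "dim (span {x, y}) = 2"
proof -
  have "dim (insert y {x}) = 2"
    using assms by (simp add: dim_insert)
  then show ?thesis
    by (simp add: insert_commute)
qed

lemma span_pair_line:
  assumes "x \<noteq> 0" and "y \<notin> span {x}"
  shows "span {x, y} \<in> lines_through (span {x})"
  using assms by (simp add: lines_through_def proj_line_def span_mono dim_span_pair del: dim_span)

lemma lines_through_image:
  assumes "linear A" and "inj A" and "A ` p = p" and "l \<in> lines_through p"
  shows "A ` l \<in> lines_through p"
proof -
  have "dim (A ` l) = dim l"
    using assms by (intro dim_image_eq) (auto intro: inj_on_subset)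
  then show ?thesis
    using assms by (auto simp: lines_through_def proj_line_def linear_subspace_image)
qed

lemma lines_eqI:
  assumes "l \<in> lines_through p" and "l' \<in> lines_through p" and "l \<subseteq> l'"
  shows "l = l'"
  using assms unfolding lines_through_def proj_line_def
  by (intro subspace_dim_equal) auto

lemma notin_span_singletonI: "\<xi> \<bullet> x = 0 \<Longrightarrow> \<xi> \<bullet> v \<noteq> 0 \<Longrightarrow> v \<notin> span {x}"
  by (auto simp: span_singleton)

lemma scale_in_span_zero:
  fixes v :: "'a::real_vector"
  assumes "k *\<^sub>R v \<in> span S" and "v \<notin> span S"
  shows "k = 0"
proof (rule ccontr)
  assume "k \<noteq> 0"
  then have "v = (1 / k) *\<^sub>R (k *\<^sub>R v)"
    by simp
  then show False
    using assms by (metis span_scale)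
qed

lemma in_span_pair_obtain:
  assumes "z \<in> span {x, y}"
  obtains c e where "z = c *\<^sub>R y + e *\<^sub>R x"
proof -
  obtain e where "z - e *\<^sub>R x \<in> span {y}"
    using assms by (auto simp: span_insert)
  then obtain c where "z - e *\<^sub>R x = c *\<^sub>R y"
    by (auto simp: span_singleton)
  then show ?thesis
    using that by (metis diff_eq_eq)
qed

lemma fixed_line_eigenvector:
  assumes "B ` span {x, y} = span {x, y}"
  obtains c e where "B y = c *\<^sub>R y + e *\<^sub>R x"
proof -
  have "B y \<in> span {x, y}"
    using assms by (metis imageI insertCI span_base)
  then show ?thesis
    using in_span_pair_obtain that by blast
qed

text \<open>Modulo \<open>x\<close>, every vector of the hyperplane is an eigenvector, hence they share one
  eigenvalue \<open>c\<close>. The axis \<open>u\<close> has another eigenvalue \<open>c'\<close>, as the transformation is not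
  trivial, and \<open>c\<^sup>2 = c'\<^sup>2\<close>, as it is an involution. Up to the factor \<open>c\<close>, a transformation
  with \<open>c' = -c\<close> is the oblique reflection.\<close>

lemma projective_involution_unique:
  fixes B :: "real ^ 'n \<Rightarrow> real ^ 'n::finite"
  assumes x: "x \<noteq> 0" "\<xi> \<bullet> x = 0" and u: "\<xi> \<bullet> u \<noteq> 0"
    and t0: "\<xi> \<bullet> t0 = 0" "t0 \<notin> span {x}"
    and B: "linear B" "inj B" "B ` span {x} = span {x}"
    and involution: "\<And>l. l \<in> lines_through (span {x}) \<Longrightarrow> B ` B ` l = l"
    and nontrivial: "l0 \<in> lines_through (span {x})" "B ` l0 \<noteq> l0"
    and axis: "B ` span {x, u} = span {x, u}"
    and hyperplane: "\<And>t. \<xi> \<bullet> t = 0 \<Longrightarrow> t \<notin> span {x} \<Longrightarrow> B ` span {x, t} = span {x, t}"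
    and l: "l \<in> lines_through (span {x})"
  shows "B ` l = oblique_reflection \<xi> u ` l"
proof -
  note B_simps = linear_add[OF B(1)] linear_diff[OF B(1)] linear_scale[OF B(1)]
  let ?A = "oblique_reflection \<xi> u"
  have "B x \<in> span {x}"
    using B(3) by (metis imageI insertI1 span_base)
  then obtain k0 where Bx: "B x = k0 *\<^sub>R x"
    by (auto simp: span_singleton)
  obtain c e0 where c: "B t0 = c *\<^sub>R t0 + e0 *\<^sub>R x"
    using fixed_line_eigenvector[OF hyperplane[OF t0]] by blast
  obtain c' e' where c': "B u = c' *\<^sub>R u + e' *\<^sub>R x"
    using fixed_line_eigenvector[OF axis] by blast
  have eigen: "\<exists>e. B t = c *\<^sub>R t + e *\<^sub>R x" if t: "\<xi> \<bullet> t = 0" for t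
  proof (cases "t \<in> span {x, t0}")
    case True
    then obtain a b where "t = a *\<^sub>R t0 + b *\<^sub>R x"
      by (rule in_span_pair_obtain)
    then have "B t = c *\<^sub>R t + (a * e0 + b * k0 - c * b) *\<^sub>R x"
      using Bx c by (simp add: B_simps algebra_simps)
    then show ?thesis
      by blast
  next
    case False
    then have t_notin: "t \<notin> span {x}"
      using span_mono[of "{x}" "{x, t0}"] by blast
    obtain c1 e1 where c1: "B t = c1 *\<^sub>R t + e1 *\<^sub>R x"
      using fixed_line_eigenvector[OF hyperplane[OF t t_notin]] by blast
    have "t + t0 \<notin> span {x}"
    proof
      assume "t + t0 \<in> span {x}"
      then have "t + t0 \<in> span {x, t0}"
        using span_mono[of "{x}" "{x, t0}"] by blast
      then have "t + t0 - t0 \<in> span {x, t0}"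
        by (rule span_diff) (simp add: span_base)
      then show False
        using False by simp
    qed
    then obtain c2 e2 where c2: "B (t + t0) = c2 *\<^sub>R (t + t0) + e2 *\<^sub>R x"
      using fixed_line_eigenvector[OF hyperplane] t t0 by (metis add_0 inner_add_right)
    have eq: "(c1 - c2) *\<^sub>R t = (c2 - c) *\<^sub>R t0 + (e2 - e1 - e0) *\<^sub>R x"
      using c1 c2 c by (simp add: B_simps algebra_simps)
    then have "(c1 - c2) *\<^sub>R t \<in> span {x, t0}"
      by (simp add: span_add span_base span_scale)
    then have "c1 = c2"
      using False by (meson eq_iff_diff_eq_0 scale_in_span_zero)
    moreover from this have "c2 = c"
    proof -
      have "(c2 - c) *\<^sub>R t0 = (e1 + e0 - e2) *\<^sub>R x"
        using eq \<open>c1 = c2\<close> by (simp add: algebra_simps)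
      then have "(c2 - c) *\<^sub>R t0 \<in> span {x}"
        by (simp add: span_base span_scale)
      then show ?thesis
        using t0(2) by (meson eq_iff_diff_eq_0 scale_in_span_zero)
    qed
    ultimately show ?thesis
      using c1 by blast
  qed
  \<comment> \<open>The coordinate along the axis in the decomposition of the space into the kernel of \<open>\<xi>\<close> and
    the line of \<open>u\<close>.\<close>
  define h where "h y = (\<xi> \<bullet> y) / (\<xi> \<bullet> u)" for y
  have B_eq: "\<exists>e. B y = c *\<^sub>R (y - h y *\<^sub>R u) + (c' * h y) *\<^sub>R u + e *\<^sub>R x" for y
  proof -
    have "\<xi> \<bullet> (y - h y *\<^sub>R u) = 0"
      using u by (simp add: h_def inner_diff_right)
    then obtain e where "B (y - h y *\<^sub>R u) = c *\<^sub>R (y - h y *\<^sub>R u) + e *\<^sub>R x"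
      using eigen by blast
    then have "B y = c *\<^sub>R (y - h y *\<^sub>R u) + (c' * h y) *\<^sub>R u + (e + h y * e') *\<^sub>R x"
      using c' by (simp add: B_simps algebra_simps)
    then show ?thesis
      by blast
  qed
  have B_lines: "B ` m \<in> lines_through (span {x})" if "m \<in> lines_through (span {x})" for m
    using B that by (rule lines_through_image)
  have "c \<noteq> c'"
  proof
    assume "c = c'"
    then have B_scalar: "\<exists>e. B y = c *\<^sub>R y + e *\<^sub>R x" for y
      using B_eq[of y] by (simp add: algebra_simps)
    have "B ` l0 \<subseteq> l0"
    proof
      fix z assume "z \<in> B ` l0"
      then obtain y where "y \<in> l0" "z = B y"
        by blast
      moreover have "subspace l0" "x \<in> l0"
        using nontrivial(1) by (auto simp: lines_through_def proj_line_def span_base)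
      ultimately show "z \<in> l0"
        using B_scalar[of y] by (auto intro!: subspace_add subspace_scale)
    qed
    then show False
      using nontrivial B_lines lines_eqI by blast
  qed
  \<comment> \<open>The square of the transformation acts on \<open>t0 + u\<close> modulo \<open>x\<close> as \<open>c\<^sup>2\<close> on \<open>t0\<close> and as
    \<open>c'\<^sup>2\<close> on \<open>u\<close>, and it fixes the line through \<open>x\<close> and \<open>t0 + u\<close>.\<close>
  moreover have "c\<^sup>2 = c'\<^sup>2"
  proof -
    have "t0 + u \<notin> span {x}"
      using u t0(1) by (intro notin_span_singletonI[OF x(2)]) (simp add: inner_add_right)
    then have "B ` B ` span {x, t0 + u} = span {x, t0 + u}"
      using x(1) by (intro involution span_pair_line)
    then have "(\<lambda>v. B (B v)) ` span {x, t0 + u} = span {x, t0 + u}"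
      by (simp only: image_image)
    then obtain k e where k: "B (B (t0 + u)) = k *\<^sub>R (t0 + u) + e *\<^sub>R x"
      by (rule fixed_line_eigenvector)
    define e'' where "e'' = (c + k0) * e0 + (c' + k0) * e'"
    have e'': "B (B (t0 + u)) = c\<^sup>2 *\<^sub>R t0 + c'\<^sup>2 *\<^sub>R u + e'' *\<^sub>R x"
      using Bx c c' by (simp add: e''_def B_simps power2_eq_square algebra_simps)
    have "\<xi> \<bullet> (k *\<^sub>R (t0 + u) + e *\<^sub>R x) = \<xi> \<bullet> (c\<^sup>2 *\<^sub>R t0 + c'\<^sup>2 *\<^sub>R u + e'' *\<^sub>R x)"
      using k e'' by simp
    then have "k = c'\<^sup>2"
      using u by (simp add: inner_add_right x t0)
    then have "(c\<^sup>2 - c'\<^sup>2) *\<^sub>R t0 = (e - e'') *\<^sub>R x"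
      using k e'' by (simp add: algebra_simps)
    then have "(c\<^sup>2 - c'\<^sup>2) *\<^sub>R t0 \<in> span {x}"
      by (simp add: span_base span_scale)
    then show ?thesis
      using t0(2) by (meson eq_iff_diff_eq_0 scale_in_span_zero)
  qed
  ultimately have "c' = - c"
    by (simp add: power2_eq_iff)
  have B_A: "\<exists>e. B y = c *\<^sub>R ?A y + e *\<^sub>R x" for y
  proof -
    have "?A y = y - (2 * h y) *\<^sub>R u"
      by (simp add: oblique_reflection_def h_def)
    moreover have "c *\<^sub>R (y - h y *\<^sub>R u) + (c' * h y) *\<^sub>R u = c *\<^sub>R (y - (2 * h y) *\<^sub>R u)"
      using \<open>c' = - c\<close> by (simp add: algebra_simps flip: scaleR_add_left)
    ultimately show ?thesis
      using B_eq[of y] by simp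
  qed
  have A_x: "?A x = x"
    using x by (simp add: oblique_reflection_fixes)
  have A_inj: "inj ?A"
    using oblique_reflection_involution[OF u] by (metis injI)
  have A_line: "?A ` l \<in> lines_through (span {x})"
    using A_x by (intro lines_through_image oblique_reflection_linear A_inj l)
      (simp add: linear_span_image[OF oblique_reflection_linear, symmetric])
  have "B ` l \<subseteq> ?A ` l"
  proof
    fix z assume "z \<in> B ` l"
    then obtain y where "y \<in> l" "z = B y"
      by blast
    moreover have "subspace (?A ` l)" "x \<in> ?A ` l"
      using A_line by (auto simp: lines_through_def proj_line_def span_base)
    ultimately show "z \<in> ?A ` l"
      using B_A[of y] by (auto intro!: subspace_add subspace_scale)
  qed
  then show ?thesis
    using A_line B_lines[OF l] lines_eqI by blast
qed

text \<open>The oblique reflection satisfies the conditions that define the projective reflection, and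
  the preceding lemma shows that nothing else does. In dimension at least three the tangent
  hyperplane is larger than the point, which both parts need: for existence, a vector \<open>t0\<close> of
  the hyperplane outside the point yields a line that is moved; for uniqueness, it fixes the
  common eigenvalue.\<close>

lemma proj_reflection_eq:
  fixes x :: "real ^ 'n::finite"
  assumes x: "x \<noteq> 0" "\<xi> \<bullet> x = 0" and u: "\<xi> \<bullet> u \<noteq> 0"
    and card: "CARD('n) \<ge> 3"
    and l: "l \<in> lines_through (span {x})"
  shows "proj_reflection (span {x}) {v. \<xi> \<bullet> v = 0} (span {x, u}) l = oblique_reflection \<xi> u ` l"
proof -
  let ?p = "span {x}" and ?L = "span {x, u}" and ?T = "{v. \<xi> \<bullet> v = 0}"
  let ?A = "oblique_reflection \<xi> u"
  let ?\<phi> = "restrict ((`) ?A) (lines_through ?p)"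
  have "\<xi> \<noteq> 0"
    using u by auto
  then have "dim ?T \<ge> 2"
    using card by (simp add: dim_hyperplane)
  then have "\<not> ?T \<subseteq> ?p"
    using x(1) dim_subset[of ?T ?p] by (auto simp: dim_singleton)
  then obtain t0 where t0: "\<xi> \<bullet> t0 = 0" "t0 \<notin> ?p"
    by blast
  have u_notin: "u \<notin> ?p"
    using x(2) u by (rule notin_span_singletonI)
  have A_linear: "linear ?A"
    by (rule oblique_reflection_linear)
  have A_x: "?A x = x"
    using x by (simp add: oblique_reflection_fixes)
  have A_A: "?A (?A v) = v" for v
    using oblique_reflection_involution[OF u] .
  then have A_bij: "bij ?A"
    by (intro o_bij[of ?A]) auto
  have A_p: "?A ` ?p = ?p"
    using A_x by (simp add: linear_span_image[OF A_linear, symmetric])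
  have A_lines: "?A ` m \<in> lines_through ?p" if "m \<in> lines_through ?p" for m
    using that A_bij by (intro lines_through_image A_linear A_p) (auto simp: bij_def)
  have A_u: "?A u = - u"
    using u by (simp add: oblique_reflection_def scaleR_2)
  define P where "P \<phi> \<longleftrightarrow> projectivity_at ?p \<phi> \<and>
        (\<forall>l\<in>lines_through ?p. \<phi> (\<phi> l) = l) \<and>
        (\<exists>l\<in>lines_through ?p. \<phi> l \<noteq> l) \<and>
        \<phi> ?L = ?L \<and>
        (\<forall>l\<in>lines_through ?p. l \<subseteq> ?T \<longrightarrow> \<phi> l = l)" for \<phi>
  have L_line: "?L \<in> lines_through ?p"
    using x u_notin by (intro span_pair_line)
  have "P ?\<phi>"
    unfolding P_def
  proof (intro conjI ballI impI)
    show "projectivity_at ?p ?\<phi>"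
      unfolding projectivity_at_def using A_linear A_bij A_p by auto
    show "?\<phi> (?\<phi> m) = m" if "m \<in> lines_through ?p" for m
      using that A_lines A_A by (simp add: image_image)
    \<comment> \<open>The line through \<open>x\<close> and \<open>t0 + u\<close> goes to the line through \<open>x\<close> and \<open>t0 - u\<close>.\<close>
    show "\<exists>m\<in>lines_through ?p. ?\<phi> m \<noteq> m"
    proof
      have notin: "t0 + u \<notin> ?p"
        using u t0(1) by (intro notin_span_singletonI[OF x(2)]) (simp add: inner_add_right)
      show line: "span {x, t0 + u} \<in> lines_through ?p"
        using x(1) notin by (rule span_pair_line)
      have "?A (t0 + u) = t0 - u"
        using A_u t0 by (simp add: linear_add[OF A_linear] oblique_reflection_fixes)
      moreover have "t0 - u \<noteq> k *\<^sub>R (t0 + u) + e *\<^sub>R x" for k e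
      proof
        assume eq: "t0 - u = k *\<^sub>R (t0 + u) + e *\<^sub>R x"
        then have "\<xi> \<bullet> (t0 - u) = \<xi> \<bullet> (k *\<^sub>R (t0 + u) + e *\<^sub>R x)"
          by simp
        then have "(k + 1) * (\<xi> \<bullet> u) = 0"
          by (simp add: inner_diff_right inner_add_right x t0 algebra_simps)
        then have "k = -1"
          using u by simp
        then have "2 *\<^sub>R t0 = e *\<^sub>R x"
          using eq by (simp add: algebra_simps scaleR_2)
        then have "t0 = (e / 2) *\<^sub>R x"
          by (metis divideR_right scaleR_scaleR divide_inverse_commute zero_neq_numeral)
        then show False
          using t0(2) by (auto simp: span_singleton)
      qed
      ultimately have "?A ` span {x, t0 + u} \<noteq> span {x, t0 + u}"
        using fixed_line_eigenvector[of ?A x "t0 + u"] by metis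
      then show "?\<phi> (span {x, t0 + u}) \<noteq> span {x, t0 + u}"
        using line by simp
    qed
    have "?A ` ?L = span {x, - u}"
      using A_x A_u by (simp add: linear_span_image[OF A_linear, symmetric])
    also have "\<dots> \<subseteq> ?L"
      by (intro span_minimal) (auto intro: span_base span_neg)
    finally have "?A ` ?L = ?L"
      using L_line A_lines lines_eqI by blast
    then show "?\<phi> ?L = ?L"
      using L_line by simp
    show "?\<phi> m = m" if "m \<in> lines_through ?p" "m \<subseteq> ?T" for m
    proof -
      have "?A ` m = (\<lambda>v. v) ` m"
        using that(2) by (intro image_cong) (auto simp: oblique_reflection_fixes)
      then show ?thesis
        using that(1) by simp
    qed
  qed
  moreover have "\<phi> = ?\<phi>" if P: "P \<phi>" for \<phi>
  proof
    fix m
    have projectivity: "projectivity_at ?p \<phi>"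
      and involution: "\<forall>l\<in>lines_through ?p. \<phi> (\<phi> l) = l"
      and nontrivial: "\<exists>l\<in>lines_through ?p. \<phi> l \<noteq> l"
      and axis: "\<phi> ?L = ?L"
      and hyperplane: "\<forall>l\<in>lines_through ?p. l \<subseteq> ?T \<longrightarrow> \<phi> l = l"
      using P unfolding P_def by simp_all
    have ext: "\<phi> \<in> extensional (lines_through ?p)"
      using projectivity by (simp add: projectivity_at_def)
    obtain B where "linear B \<and> bij B \<and> B ` ?p = ?p \<and> (\<forall>m\<in>lines_through ?p. \<phi> m = B ` m)"
      using conjunct2[OF projectivity[unfolded projectivity_at_def]] ..
    then have B: "linear B" "bij B" "B ` ?p = ?p" "\<And>m. m \<in> lines_through ?p \<Longrightarrow> \<phi> m = B ` m"
      by auto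
    have B_lines: "B ` m \<in> lines_through ?p" if "m \<in> lines_through ?p" for m
      using that B by (intro lines_through_image) (auto simp: bij_def)
    show "\<phi> m = ?\<phi> m"
    proof (cases "m \<in> lines_through ?p")
      case True
      obtain l0 where l0: "l0 \<in> lines_through ?p" "B ` l0 \<noteq> l0"
        using nontrivial B(4) by auto
      have "B ` m = ?A ` m"
      proof (rule projective_involution_unique[OF x u t0 B(1) _ B(3) _ l0 _ _ True])
        show "inj B"
          using B(2) by (simp add: bij_def)
        show "B ` B ` m = m" if "m \<in> lines_through ?p" for m
          using bspec[OF involution that] by (simp add: B(4) B_lines that)
        show "B ` ?L = ?L"
          using axis B(4)[OF L_line] by simp
        show "B ` span {x, t} = span {x, t}" if t: "\<xi> \<bullet> t = 0" "t \<notin> ?p" for t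
        proof -
          have "span {x, t} \<subseteq> ?T"
            using x t by (intro span_minimal) (auto simp: subspace_hyperplane)
          then show ?thesis
            using hyperplane B(4) span_pair_line[OF x(1) t(2)] by auto
        qed
      qed
      then show ?thesis
        using True B(4) by simp
    next
      case False
      then show ?thesis
        using ext by (simp add: extensional_def)
    qed
  qed
  ultimately have "proj_reflection ?p ?T ?L = ?\<phi>"
    unfolding proj_reflection_def P_def[symmetric] by (intro the_equality)
  then show ?thesis
    using l by simp
qed

section \<open>Confocal quadrics are caustics\<close>

text \<open>The equation \<open>M\<^sub>1 x\<close> of the tangent hyperplane at \<open>x\<close> determines its pole: \<open>w\<close> lies in the
  pole when \<open>M\<^sub>2 w\<close> annihilates this hyperplane, hence is proportional to \<open>M\<^sub>1 x\<close>. The line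
  through \<open>x\<close> and the pole is transverse exactly when the pole is off the hyperplane.\<close>

lemma line_frame_obtain:
  fixes q1 q2 :: "'n::finite form"
  assumes q1: "quadratic_form q1" "nondegenerate q1"
    and q2: "quadratic_form q2" "nondegenerate q2"
    and frame: "(p, L) \<in> line_frame (quadric q1) q2"
  obtains x where "x \<noteq> 0" and "p = span {x}" and "q1 x x = 0"
    and "tangent_space (quadric q1) p = {v. (form_matrix q1 *v x) \<bullet> v = 0}"
    and "L = span {x, matrix_inv (form_matrix q2) *v (form_matrix q1 *v x)}"
    and "(form_matrix q1 *v x) \<bullet> (matrix_inv (form_matrix q2) *v (form_matrix q1 *v x)) \<noteq> 0"
proof -
  have p: "p \<in> quadric q1"
    and L: "L = span (p \<union> pole q2 (tangent_space (quadric q1) p))"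
    and transverse: "\<not> L \<subseteq> tangent_space (quadric q1) p"
    using frame by (auto simp: line_frame_def transverse_line_at_def)
  obtain x where x: "x \<noteq> 0" "p = span {x}"
    using p proj_point_obtain by (auto simp: quadric_def)
  define \<xi> where "\<xi> = form_matrix q1 *v x"
  define u where "u = matrix_inv (form_matrix q2) *v \<xi>"
  have xx: "q1 x x = 0"
    using p x q1 by (simp add: span_in_quadric_iff)
  have T: "tangent_space (quadric q1) p = {v. \<xi> \<bullet> v = 0}"
    using tangent_space_quadric[OF q1 x(1)] p x(2)
    by (simp add: \<xi>_def form_matrix_works[OF q1(1)])
  have \<xi>_x: "\<xi> \<bullet> x = 0"
    using xx by (simp add: \<xi>_def form_matrix_works[OF q1(1)])
  have u_eq: "form_matrix q2 *v u = \<xi>"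
    by (simp add: u_def form_matrix_inverse q2)
  have pole: "pole q2 {v. \<xi> \<bullet> v = 0} = span {u}"
  proof (intro set_eqI iffI)
    fix w
    assume "w \<in> span {u}"
    then show "w \<in> pole q2 {v. \<xi> \<bullet> v = 0}"
      by (auto simp: span_singleton pole_def form_matrix_works[OF q2(1)]
          matrix_vector_mult_scaleR u_eq)
  next
    fix w
    assume "w \<in> pole q2 {v. \<xi> \<bullet> v = 0}"
    then have w: "(form_matrix q2 *v w) \<bullet> v = 0" if "\<xi> \<bullet> v = 0" for v
      using that by (simp add: pole_def form_matrix_works[OF q2(1)])
    \<comment> \<open>The component \<open>r\<close> of \<open>M\<^sub>2 w\<close> orthogonal to \<open>\<xi>\<close> lies in the hyperplane that \<open>M\<^sub>2 w\<close>
      annihilates.\<close>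
    define k where "k = (form_matrix q2 *v w) \<bullet> \<xi> / (\<xi> \<bullet> \<xi>)"
    define r where "r = form_matrix q2 *v w - k *\<^sub>R \<xi>"
    have "\<xi> \<bullet> r = 0"
      by (simp add: r_def k_def inner_diff_right inner_commute)
    then have "r \<bullet> r = 0"
      using w[of r] inner_diff_left[of "form_matrix q2 *v w" "k *\<^sub>R \<xi>" r]
      by (simp flip: r_def)
    then have "form_matrix q2 *v w = form_matrix q2 *v (k *\<^sub>R u)"
      by (simp add: r_def matrix_vector_mult_scaleR u_eq)
    then have "w = k *\<^sub>R u"
      by (metis form_matrix_inverse(2) q2)
    then show "w \<in> span {u}"
      by (auto simp: span_singleton)
  qed
  have L_eq: "L = span {x, u}"
  proof -
    have "span (span {x} \<union> span {u}) = span ({x} \<union> {u})"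
      by (simp only: span_Un span_span)
    then show ?thesis
      unfolding L T pole unfolding x(2) by (simp add: insert_commute)
  qed
  have \<xi>_u: "\<xi> \<bullet> u \<noteq> 0"
  proof
    assume "\<xi> \<bullet> u = 0"
    then have "span {x, u} \<subseteq> {v. \<xi> \<bullet> v = 0}"
      using \<xi>_x by (intro span_minimal) (auto simp: subspace_hyperplane)
    then show False
      using transverse T L_eq by simp
  qed
  show ?thesis
    using x xx T L_eq \<xi>_u unfolding u_def unfolding \<xi>_def by (rule that)
qed

text \<open>If \<open>\<eta>\<close> witnesses that \<open>l\<close> is tangent, then its image under the transpose of the reflection
  \<open>A\<close> witnesses it for \<open>A ` l\<close>. It vanishes on \<open>A ` l\<close> because \<open>A\<close> is an involution. The
  hypothesis on \<open>N \<xi>\<close> makes \<open>N\<close> intertwine \<open>A\<close> and its transpose on \<open>\<eta>\<close> up to a multiple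
  of \<open>x\<close>, which belongs to \<open>A ` l\<close>.\<close>

lemma confocal_reflection_tangent:
  fixes h :: "'n::finite form"
  assumes h: "quadratic_form h" "nondegenerate h"
    and x: "\<xi> \<bullet> x = 0" and u: "\<xi> \<bullet> u \<noteq> 0"
    and h_\<xi>: "form_matrix h *v \<xi> = a *\<^sub>R x + b *\<^sub>R u"
    and "x \<in> l" and tangent: "tangent_line l (quadric (dual_form h))"
  shows "tangent_line (oblique_reflection \<xi> u ` l) (quadric (dual_form h))"
proof -
  let ?A = "oblique_reflection \<xi> u" and ?N = "form_matrix h"
  have A_linear: "linear ?A"
    by (rule oblique_reflection_linear)
  have A_A: "?A (?A v) = v" for v
    using oblique_reflection_involution[OF u] .
  obtain \<eta> where l: "proj_line l"
    and \<eta>: "\<eta> \<noteq> 0" "\<And>z. z \<in> l \<Longrightarrow> \<eta> \<bullet> z = 0" "?N *v \<eta> \<in> l"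
    using tangent unfolding tangent_line_dual_quadric_iff[OF h] by blast
  have "inj ?A"
    using A_A by (metis injI)
  then have A_l: "proj_line (?A ` l)"
    using l dim_image_eq[OF A_linear, of l]
    by (auto simp: proj_line_def linear_subspace_image[OF A_linear] intro: inj_on_subset)
  define \<eta>' where "\<eta>' = oblique_reflection u \<xi> \<eta>"
  define k where "k = 2 * (u \<bullet> \<eta>) / (\<xi> \<bullet> u)"
  have "\<eta>' \<noteq> 0"
  proof
    assume "\<eta>' = 0"
    then have "\<eta> \<bullet> ?A (?A \<eta>) = 0"
      by (metis \<eta>'_def inner_zero_left oblique_reflection_transpose)
    then show False
      using \<eta>(1) A_A by simp
  qed
  moreover have "\<eta>' \<bullet> z = 0" if "z \<in> ?A ` l" for z
    using that \<eta>(2) A_A by (auto simp: \<eta>'_def oblique_reflection_transpose)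
  moreover have "?N *v \<eta>' \<in> ?A ` l"
  proof -
    have "\<xi> \<bullet> (?N *v \<eta>) = (?N *v \<xi>) \<bullet> \<eta>"
      using h by (simp add: form_matrix_symmetric)
    also have "\<dots> = b * (u \<bullet> \<eta>)"
      using \<eta>(2)[OF \<open>x \<in> l\<close>] by (simp add: h_\<xi> inner_add_left inner_commute[of x])
    finally have "?A (?N *v \<eta>) = ?N *v \<eta> - (k * b) *\<^sub>R u"
      by (simp add: oblique_reflection_def k_def)
    moreover have "?N *v \<eta>' = ?N *v \<eta> - k *\<^sub>R (a *\<^sub>R x + b *\<^sub>R u)"
      by (simp add: \<eta>'_def oblique_reflection_def k_def h_\<xi> matrix_vector_mult_diff_distrib
          matrix_vector_mult_scaleR inner_commute)
    ultimately have "?N *v \<eta>' = ?A (?N *v \<eta>) - (k * a) *\<^sub>R x"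
      by (simp add: scaleR_add_right)
    also have "\<dots> = ?A (?N *v \<eta> - (k * a) *\<^sub>R x)"
      using x by (simp add: linear_diff[OF A_linear] linear_scale[OF A_linear]
          oblique_reflection_fixes)
    also have "\<dots> \<in> ?A ` l"
      using l \<eta>(3) \<open>x \<in> l\<close> by (auto simp: proj_line_def intro!: subspace_diff subspace_scale)
    finally show ?thesis .
  qed
  ultimately show ?thesis
    using A_l unfolding tangent_line_dual_quadric_iff[OF h] by blast
qed

theorem corollary2p39:
  fixes d :: nat and q1 q2 q :: "'n::finite form"
  assumes "d \<ge> 2" and "CARD('n) = d + 1"
    and "quadratic_form q1" and "nondegenerate q1"
    and "quadratic_form q2" and "nondegenerate q2"
    and "quadric q1 \<noteq> {}" and "quadric q2 \<noteq> {}"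
    and "quadric q1 \<noteq> quadric q2"
    and "q \<in> dual_pencil (dual_form q1) (dual_form q2)"
    and "quadric q \<noteq> quadric q1"
  shows "caustic (quadric q) (quadric q1) (line_frame (quadric q1) q2)"
proof -
  note q1 = assms(3,4) and q2 = assms(5,6)
  obtain a b where q: "q = dual_form (\<lambda>x y. a * dual_form q1 x y + b * dual_form q2 x y)"
    and h: "nondegenerate (\<lambda>x y. a * dual_form q1 x y + b * dual_form q2 x y)"
    using assms(10) unfolding dual_pencil_def pencil_def by blast
  let ?h = "\<lambda>x y. a * dual_form q1 x y + b * dual_form q2 x y"
  have h': "quadratic_form ?h"
    by (intro pencil_quadratic_form dual_form_quadratic q1 q2)
  show ?thesis
    unfolding caustic_def
  proof (rule conjI[OF _ ballI])
    show "hypersurface (quadric q)"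
      unfolding q
      by (intro quadric_hypersurface dual_form_quadratic dual_form_nondegenerate h h')
  next
    show "case pL of (p, L) \<Rightarrow> \<forall>l. tangent_line l (quadric q) \<and> transverse_line_at l (quadric q1) p \<longrightarrow>
        tangent_line (proj_reflection p (tangent_space (quadric q1) p) L l) (quadric q)"
      if "pL \<in> line_frame (quadric q1) q2" for pL
    proof (clarify)
      fix p L l
      assume "pL = (p, L)" and l: "tangent_line l (quadric q)" "transverse_line_at l (quadric q1) p"
      then have "(p, L) \<in> line_frame (quadric q1) q2"
        using that by simp
      then obtain x \<xi> u where x: "x \<noteq> 0" "p = span {x}" "q1 x x = 0"
        and T: "tangent_space (quadric q1) p = {v. \<xi> \<bullet> v = 0}"
        and L: "L = span {x, u}" and \<xi>_u: "\<xi> \<bullet> u \<noteq> 0"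
        and \<xi>: "\<xi> = form_matrix q1 *v x" and u: "u = matrix_inv (form_matrix q2) *v \<xi>"
        using line_frame_obtain[OF q1 q2] by metis
      have \<xi>_x: "\<xi> \<bullet> x = 0"
        using x(3) by (simp add: \<xi> form_matrix_works[OF q1(1)])
      have "form_matrix ?h *v \<xi> = a *\<^sub>R x + b *\<^sub>R u"
        using form_matrix_inverse(2)[OF q1, of x]
        by (simp add: form_matrix_pencil dual_form_quadratic q1 q2 form_matrix_dual \<xi> u
            matrix_vector_mult_add_rdistrib flip: scaleR_matrix_vector_assoc)
      moreover have "l \<in> lines_through (span {x})" "x \<in> l"
        using l(2) x(2) by (auto simp: transverse_line_at_def lines_through_def span_base)
      moreover have "proj_reflection p {v. \<xi> \<bullet> v = 0} L l = oblique_reflection \<xi> u ` l"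
        unfolding x(2) L using assms(1,2) calculation(2)
        by (intro proj_reflection_eq x(1) \<xi>_x \<xi>_u) simp_all
      ultimately show "tangent_line (proj_reflection p (tangent_space (quadric q1) p) L l) (quadric q)"
        using confocal_reflection_tangent[OF h' h \<xi>_x \<xi>_u] l(1) by (simp only: T q)
    qed
  qed
qed

end
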